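(* Let $p,q\in\mathbb{N}$ be co-prime and $\theta=\tan^{-1}(p/q)$. Then $\dim(\mu_\theta)<1$.
   Context: Throughout, $p,q\in\mathbb{N}$ are co-prime with $p/q\in[0,1]$. Let $D=\{0,1,p/q\}$. The measure $\mu_\theta$ is the unique Borel probability measure on $\mathbb{R}$ satisfying $\mu_\theta(A)=\tfrac13\big(\mu_\theta(2A)+\mu_\theta(2A-1)+\mu_\theta(2A-p/q)\big)$ for all Borel $A$; equivalently, the distribution of $\sum_{i\ge1}a_i2^{-i}$ with $a_i$ i.i.d. uniform on $D$ (the projection of the uniform measure on the Sierpinski triangle along lines of slope determined by $\theta$). $\dim(\mu_\theta)$ denotes the (Hausdorff) dimension of the measure $\mu_\theta$ (self-similar measures are exact dimensional, so the usual notions of dimension of a measure coincide). *)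

theory Defs
  imports "HOL-Probability.Probability"
begin

text \<open>The digit distribution: uniform on the three digits 0, 1, t (counted with
  multiplicity, matching the weights 1/3 in the self-similarity equation).\<close>
definition digit_pmf :: "real \<Rightarrow> real pmf" where
  "digit_pmf t = pmf_of_multiset {#0, 1, t#}"

definition proj_measure :: "real \<Rightarrow> real measure" where
  "proj_measure t =
     distr (PiM UNIV (\<lambda>_::nat. measure_pmf (digit_pmf t))) borel
           (\<lambda>\<omega>. \<Sum>i. \<omega> i / 2 ^ (Suc i))"

definition hausdorff_pre :: "real \<Rightarrow> real \<Rightarrow> real set \<Rightarrow> ennreal" where
  "hausdorff_pre s \<delta> A =
     (INF U \<in> {U :: nat \<Rightarrow> real set. A \<subseteq> (\<Union>i. U i) \<and>
                 (\<forall>i. bounded (U i) \<and> diameter (U i) \<le> \<delta>)}.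
        (\<Sum>i. ennreal (diameter (U i) powr s)))"

definition hausdorff_measure :: "real \<Rightarrow> real set \<Rightarrow> ennreal" where
  "hausdorff_measure s A = (SUP \<delta> \<in> {0<..}. hausdorff_pre s \<delta> A)"

definition hausdorff_dim :: "real set \<Rightarrow> real" where
  "hausdorff_dim A = Inf {s. 0 \<le> s \<and> hausdorff_measure s A = 0}"

definition measure_hausdorff_dim :: "real measure \<Rightarrow> real" where
  "measure_hausdorff_dim \<mu> =
     Inf {hausdorff_dim A | A. A \<in> sets borel \<and> emeasure \<mu> (UNIV - A) = 0}"

end

theory Submission
  imports Defs
begin

text \<open>Write \<open>e(x) = exp (2 \<pi> i x)\<close>, let \<open>X\<close> have law \<open>\<mu>\<close> and let \<open>y\<^sub>n\<close> be the integer \<open>q 2\<^sup>n\<close> times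
  the \<open>n\<close>-th partial sum of \<open>X\<close>. Fix \<open>k\<close> with \<open>2\<^sup>k \<ge> 6 q\<close> and consider the walk
  \<open>S\<^sub>N(y) = \<Sum>\<^sub>j Re (u e(y / 2\<^sup>k\<^sup>j))\<close>, \<open>1 \<le> j \<le> N\<close>, with a suitable \<open>u\<close> of modulus one. For uniformly
  distributed residues \<open>y\<close> modulo \<open>2\<^sup>k\<^sup>N\<close> each step has conditional mean zero given the lower binary
  digits. For \<open>y = y\<^sub>k\<^sub>N\<close> the conditional mean is instead bounded below by a positive constant, because
  the Fourier coefficients of the law of \<open>q X\<close> at powers of two are products of values of
  \<open>(1 + e(q a) + e(p a)) / 3\<close> at \<open>a = 2\<^sup>-\<^sup>j\<close>, none of which vanishes. Chernoff bounds on both sides yield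
  sets of integers that carry \<open>y\<^sub>k\<^sub>N\<close> up to exponentially small probability and contain an
  exponentially small proportion of all candidates. The limes superior of the corresponding
  unions of intervals has full measure and dimension less than one.\<close>

section \<open>Trigonometric and exponential preliminaries\<close>

definition wave :: "real \<Rightarrow> complex" where
  "wave x = cis (2 * pi * x)"

lemma wave_add: "wave (x + y) = wave x * wave y"
  by (simp add: wave_def cis_mult ring_distribs)

lemma norm_wave [simp]: "norm (wave x) = 1"
  by (simp add: wave_def)

lemma wave_0 [simp]: "wave 0 = 1"
  by (simp add: wave_def)

lemma wave_of_nat [simp]: "wave (real n) = 1"
  by (simp add: wave_def cis_multiple_2pi)

lemma wave_power: "wave x ^ n = wave (real n * x)"
  by (induction n) (simp_all add: wave_add ring_distribs)

lemma wave_eq_1_imp_int: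
  assumes "wave x = 1"
  obtains m :: int where "x = of_int m"
proof -
  have "cos (2 * pi * x) = 1"
    using assms by (simp add: wave_def complex_eq_iff)
  then obtain m :: int where "2 * pi * x = of_int m * 2 * pi"
    by (auto simp: cos_one_2pi_int)
  then show thesis using that[of m] by simp
qed

text \<open>Splitting off the residue modulo \<open>b\<close> allows sums to be evaluated one block
  of binary digits at a time, with the lower digits held fixed.\<close>

lemma sum_lessThan_mult:
  fixes f :: "nat \<Rightarrow> 'a::comm_monoid_add"
  shows "(\<Sum>y<a * b. f y) = (\<Sum>y<b. \<Sum>z<a. f (y + b * z))"
proof -
  have "(\<Sum>y<a * b. f y) = (\<Sum>z<a. sum f {z * b..<z * b + b})"
    by (simp add: sum.nat_group)
  also have "\<dots> = (\<Sum>z<a. \<Sum>y<b. f (y + b * z))"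
  proof (rule sum.cong[OF refl])
    fix z
    show "sum f {z * b..<z * b + b} = (\<Sum>y<b. f (y + b * z))"
      using sum.shift_bounds_nat_ivl[of f 0 "z * b" b]
      by (simp add: lessThan_atLeast0 mult.commute add.commute)
  qed
  also have "\<dots> = (\<Sum>y<b. \<Sum>z<a. f (y + b * z))"
    by (rule sum.swap)
  finally show ?thesis .
qed

lemma exp_le_quadratic:
  fixes x :: real
  assumes "\<bar>x\<bar> \<le> 1"
  shows "exp x \<le> 1 + x + x\<^sup>2"
proof (cases "0 \<le> x")
  case True
  then show ?thesis using assms by (intro exp_bound) auto
next
  case False
  define y where "y = - x"
  have y: "0 < y" using False by (simp add: y_def)
  \<comment> \<open>The second factor is a lower bound for \<open>exp y\<close>, and the product
    exceeds 1 because all negative terms cancel.\<close>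
  have "1 \<le> (1 - y + y\<^sup>2) * (1 + y + y\<^sup>2 / 2)"
  proof -
    have "(1 - y + y\<^sup>2) * (1 + y + y\<^sup>2 / 2) = 1 + (y\<^sup>2 + y ^ 3 + y ^ 4) / 2"
      by (simp add: field_simps power2_eq_square power3_eq_cube power4_eq_xxxx)
    then show ?thesis using y by simp
  qed
  also have "\<dots> \<le> (1 - y + y\<^sup>2) * exp y"
  proof (rule mult_left_mono)
    show "1 + y + y\<^sup>2 / 2 \<le> exp y" using y by (intro exp_lower_Taylor_quadratic) simp
    have "y\<^sup>2 - y + 1 = (y - 1/2)\<^sup>2 + 3/4"
      by (simp add: power2_eq_square field_simps)
    moreover have "0 \<le> (y - 1/2)\<^sup>2" by simp
    ultimately show "0 \<le> 1 - y + y\<^sup>2" by linarith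
  qed
  finally have "exp (- y) \<le> 1 - y + y\<^sup>2"
    by (simp add: exp_minus field_simps)
  then show ?thesis by (simp add: y_def)
qed

section \<open>Large deviations of the digit walk\<close>

text \<open>Since \<open>p \<le> q\<close>, the carry out of the lower digits is at most
  \<open>q\<close>. By \<open>6 * q \<le> 2 ^ k\<close> it turns the phase of the next block by at
  most \<open>pi / 3\<close>, where the cosine is still at least 1/2.\<close>

locale digit_walk =
  fixes p q k :: nat
  assumes q_pos: "0 < q" and p_le_q: "p \<le> q" and q_le_base: "6 * q \<le> 2 ^ k"
begin

text \<open>The expectation of \<open>f (\<Sum>i<n. 2 ^ i * b i)\<close> for independent \<open>b i\<close>, each uniform
  on the multiset \<open>{#0, q, p#}\<close>.\<close>
primrec dmean :: "nat \<Rightarrow> (nat \<Rightarrow> 'a::real_normed_field) \<Rightarrow> 'a" where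
  "dmean 0 f = f 0"
| "dmean (Suc n) f =
     (dmean n f + dmean n (\<lambda>y. f (y + 2 ^ n * q)) + dmean n (\<lambda>y. f (y + 2 ^ n * p))) / 3"

lemma dmean_sum: "dmean n (\<lambda>y. f y + g y) = dmean n f + dmean n g"
  by (induction n arbitrary: f g) (simp_all add: field_simps)

lemma dmean_mult_left: "dmean n (\<lambda>y. c * f y) = c * dmean n f"
  by (induction n arbitrary: f) (simp_all add: field_simps)

lemma dmean_divide: "dmean n (\<lambda>y. f y / c) = dmean n f / c"
  using dmean_mult_left[of n "1 / c" f] by simp

lemma dmean_const [simp]: "dmean n (\<lambda>y. c) = c"
  by (induction n) simp_all

text \<open>The lower \<open>m\<close> digits are independent of the upper \<open>n\<close>, so the
  upper ones can be averaged first.\<close>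

lemma dmean_add:
  "dmean (m + n) f = dmean m (\<lambda>y. dmean n (\<lambda>z. f (y + 2 ^ m * z)))"
proof (induction n arbitrary: f)
  case 0
  show ?case by simp
next
  case (Suc n)
  have "dmean (m + Suc n) f = (dmean (m + n) f + dmean (m + n) (\<lambda>y. f (y + 2 ^ (m + n) * q))
      + dmean (m + n) (\<lambda>y. f (y + 2 ^ (m + n) * p))) / 3"
    by simp
  also have "\<dots> = dmean m (\<lambda>y. dmean (Suc n) (\<lambda>z. f (y + 2 ^ m * z)))"
    by (simp add: Suc.IH dmean_sum dmean_divide power_add algebra_simps)
  finally show ?case .
qed

text \<open>The values averaged by \<open>dmean n\<close> are at most
  \<open>q * (2 ^ n - 1)\<close>. This range later bounds the carries and gives the upper limit in
  \<open>good\<close>.\<close>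

lemma dmean_mono:
  fixes f g :: "nat \<Rightarrow> real"
  assumes "\<And>y. y + q \<le> q * 2 ^ n \<Longrightarrow> f y \<le> g y"
  shows "dmean n f \<le> dmean n g"
  using assms
proof (induction n arbitrary: f g)
  case 0
  then show ?case by simp
next
  case (Suc n)
  have *: "dmean n (\<lambda>y. f (y + 2 ^ n * b)) \<le> dmean n (\<lambda>y. g (y + 2 ^ n * b))" if "b \<le> q" for b
  proof (rule Suc.IH)
    fix y assume y: "y + q \<le> q * 2 ^ n"
    have "2 ^ n * b \<le> q * 2 ^ n" using that by simp
    moreover have "q * 2 ^ Suc n = q * 2 ^ n + q * 2 ^ n" by simp
    ultimately have "(y + 2 ^ n * b) + q \<le> q * 2 ^ Suc n" using y by linarith
    then show "f (y + 2 ^ n * b) \<le> g (y + 2 ^ n * b)" by (rule Suc.prems)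
  qed
  show ?case using *[of 0] *[of q] *[of p] p_le_q by simp
qed

lemma Re_dmean: "Re (dmean n f) = dmean n (\<lambda>y. Re (f y))"
  by (induction n arbitrary: f) simp_all

section \<open>Fourier coefficients of the digit law\<close>

definition char_fn :: "real \<Rightarrow> complex" where
  "char_fn a = (1 + wave (a * q) + wave (a * p)) / 3"

text \<open>Independence makes the mean factorise; the digit in place \<open>l\<close> sees the
  frequency \<open>2 ^ l * a\<close>.\<close>

lemma dmean_wave: "dmean n (\<lambda>y. wave (a * real y)) = (\<Prod>l<n. char_fn (2 ^ l * a))"
proof (induction n)
  case 0
  show ?case by simp
next
  case (Suc n)
  have *: "dmean n (\<lambda>y. wave (a * real (y + 2 ^ n * b)))
      = wave (2 ^ n * a * b) * dmean n (\<lambda>y. wave (a * real y))" for b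
  proof -
    have "a * real (y + 2 ^ n * b) = 2 ^ n * a * b + a * real y" for y
      by (simp add: algebra_simps)
    then show ?thesis by (simp only: wave_add dmean_mult_left)
  qed
  show ?case
    by (simp only: dmean.simps * Suc.IH prod.lessThan_Suc)
       (simp add: char_fn_def algebra_simps)
qed

text \<open>If \<open>1 + z + w = 0\<close> with \<open>z\<close> and \<open>w\<close> on the unit circle, then \<open>z\<close> is a primitive cube root
  of unity, but a root of unity of order \<open>2 ^ j\<close> is not.\<close>
lemma char_fn_nonzero: "char_fn (1 / 2 ^ m) \<noteq> 0"
proof
  assume "char_fn (1 / 2 ^ m) = 0"
  define z where "z = wave (q / 2 ^ m)"
  define w where "w = wave (p / 2 ^ m)"
  have "w = - 1 - z"
    using \<open>char_fn (1 / 2 ^ m) = 0\<close>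
    by (simp add: char_fn_def z_def w_def add_eq_0_iff algebra_simps)
  moreover have "(Re w)\<^sup>2 + (Im w)\<^sup>2 = 1" "(Re z)\<^sup>2 + (Im z)\<^sup>2 = 1"
    using norm_wave by (simp_all add: z_def w_def wave_def)
  ultimately have "(- 1 - Re z)\<^sup>2 + (Im z)\<^sup>2 = 1" "(Re z)\<^sup>2 + (Im z)\<^sup>2 = 1"
    by simp_all
  \<comment> \<open>Subtracting the two circle equations leaves
    \<open>1 + 2 * Re z = 0\<close>.\<close>
  then have re: "Re z = - 1 / 2"
    by (simp add: power2_eq_square algebra_simps)
  then have im: "(Im z)\<^sup>2 = 3 / 4"
    using \<open>(Re z)\<^sup>2 + (Im z)\<^sup>2 = 1\<close> by (simp add: power2_eq_square)
  have "z ^ 3 = 1"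
    using im by (simp add: complex_eq_iff power3_eq_cube re power2_eq_square algebra_simps)
  then have "wave (3 * real q / 2 ^ m) = 1"
    by (simp add: z_def wave_power)
  then obtain n where "3 * real q / 2 ^ m = of_int n"
    by (rule wave_eq_1_imp_int)
  then have "real_of_int (3 * int q) = real_of_int (n * 2 ^ m)"
    by (simp add: field_simps)
  then have "3 * int q = n * 2 ^ m"
    by (simp only: of_int_eq_iff)
  then have "2 ^ m dvd 3 * int q"
    by simp
  moreover have "coprime (2 ^ m) (3 :: int)"
    by simp
  ultimately have "2 ^ m dvd int q"
    by (simp add: coprime_dvd_mult_right_iff)
  then have "2 ^ m dvd q"
    using int_dvd_int_iff[of "2 ^ m" q] by simp
  then obtain d where "q = 2 ^ m * d" ..
  then have "z = 1"
    by (simp add: z_def)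
  with re show False by simp
qed

section \<open>The walk and its conditional means\<close>

definition bias :: complex where
  "bias = dmean k (\<lambda>y. wave (real y / 2 ^ k))"

text \<open>The factor \<open>cnj (sgn bias)\<close> rotates the wave so that its mean over a block
  without carry is the positive number \<open>norm bias\<close>.\<close>

definition test :: "real \<Rightarrow> real" where
  "test x = Re (cnj (sgn bias) * wave x)"

definition walk :: "nat \<Rightarrow> nat \<Rightarrow> real" where
  "walk N y = (\<Sum>j<N. test (real y / 2 ^ (k * Suc j)))"

lemma bias_nonzero: "bias \<noteq> 0"
proof -
  have "bias = (\<Prod>l<k. char_fn (2 ^ l * (1 / 2 ^ k)))"
    using dmean_wave[of k "1 / 2 ^ k"] by (simp add: bias_def)
  moreover have "char_fn (2 ^ l * (1 / 2 ^ k)) \<noteq> 0" if "l < k" for l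
  proof -
    have "2 ^ k = (2 ^ l * 2 ^ (k - l) :: real)"
      using that by (simp flip: power_add)
    then have "2 ^ l * (1 / 2 ^ k) = (1 / 2 ^ (k - l) :: real)"
      by simp
    then show ?thesis using char_fn_nonzero by simp
  qed
  ultimately show ?thesis by simp
qed

lemma cnj_sgn_bias: "cnj (sgn bias) * bias = norm bias"
  using complex_norm_square[of bias] bias_nonzero
  by (simp add: sgn_div_norm scaleR_conv_of_real power2_eq_square field_simps)

lemma abs_test_le: "\<bar>test x\<bar> \<le> 1"
proof -
  have "\<bar>test x\<bar> \<le> norm (cnj (sgn bias) * wave x)"
    unfolding test_def by (rule abs_Re_le_cmod)
  also have "\<dots> = 1" using bias_nonzero by (simp add: norm_mult norm_sgn)
  finally show ?thesis .
qed

lemma test_add_nat: "test (x + real n) = test x"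
  by (simp add: test_def wave_add)

text \<open>For \<open>j < N\<close> the shift changes \<open>y / 2 ^ (k * Suc j)\<close> by an
  integer.\<close>

lemma walk_add_multiple: "walk N (y + 2 ^ (k * N) * z) = walk N y"
  unfolding walk_def
proof (rule sum.cong[OF refl])
  fix j assume "j \<in> {..<N}"
  then have "k * Suc j \<le> k * N" by (intro mult_le_mono2) auto
  then obtain d where d: "k * N = k * Suc j + d" using le_Suc_ex by blast
  have "real (y + 2 ^ (k * N) * z) / 2 ^ (k * Suc j)
      = real y / 2 ^ (k * Suc j) + real (2 ^ d * z)"
    unfolding d by (simp add: power_add field_simps)
  then show "test (real (y + 2 ^ (k * N) * z) / 2 ^ (k * Suc j)) = test (real y / 2 ^ (k * Suc j))"
    by (simp only: test_add_nat)
qed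

text \<open>The new step depends on the lower digits only through the carry
  \<open>y / 2 ^ (k * N)\<close>, so its conditional mean can be computed for each fixed
  carry.\<close>

lemma walk_Suc:
  "walk (Suc N) (y + 2 ^ (k * N) * z)
     = walk N y + test ((real y / 2 ^ (k * N) + real z) / 2 ^ k)"
proof -
  have "real (y + 2 ^ (k * N) * z) / 2 ^ (k * Suc N) = (real y / 2 ^ (k * N) + real z) / 2 ^ k"
    by (simp add: power_add field_simps)
  then show ?thesis
    using walk_add_multiple[of N y z] by (simp add: walk_def)
qed

lemma base_pos: "0 < k"
  using q_pos q_le_base by (cases k) auto

text \<open>Whatever the carry \<open>x\<close>, this is a rotated sum over all roots of unity of
  order \<open>2 ^ k\<close>.\<close>

lemma sum_test_eq_0: "(\<Sum>z<2 ^ k. test ((x + real z) / 2 ^ k)) = 0"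
proof -
  define w where "w = wave (1 / 2 ^ k)"
  have "w \<noteq> 1"
  proof
    assume "w = 1"
    then obtain m where m: "1 / 2 ^ k = real_of_int m"
      unfolding w_def by (rule wave_eq_1_imp_int)
    have "0 < 1 / (2 ^ k :: real)" "1 / (2 ^ k :: real) < 1"
      using base_pos by simp_all
    then have "0 < m" "m < 1" unfolding m by simp_all
    then show False by simp
  qed
  moreover have "w ^ (2 ^ k) = 1"
    using wave_of_nat[of 1] by (simp add: w_def wave_power)
  ultimately have *: "(\<Sum>z<2 ^ k. w ^ z) = 0"
    by (simp add: sum_gp_strict)
  have "(\<Sum>z<2 ^ k. test ((x + real z) / 2 ^ k))
      = Re (\<Sum>z<2 ^ k. cnj (sgn bias) * wave (x / 2 ^ k) * w ^ z)"
    by (simp add: test_def w_def wave_power wave_add add_divide_distrib mult.assoc)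
  also have "\<dots> = 0"
    by (simp only: * mult_zero_right sum_distrib_left[symmetric]) simp
  finally show ?thesis .
qed

text \<open>The carry only multiplies the block mean by \<open>wave (x / 2 ^ k)\<close>, whose angle
  lies between 0 and \<open>pi / 3\<close>; at least half of \<open>norm bias\<close>
  survives.\<close>

lemma dmean_test_ge:
  assumes "0 \<le> x" "x \<le> real q"
  shows "norm bias / 2 \<le> dmean k (\<lambda>z. test ((x + real z) / 2 ^ k))"
proof -
  have "dmean k (\<lambda>z. test ((x + real z) / 2 ^ k))
      = Re (cnj (sgn bias) * wave (x / 2 ^ k) * bias)"
    by (simp add: test_def wave_add add_divide_distrib bias_def Re_dmean
          dmean_mult_left[symmetric] mult.assoc)
  also have "cnj (sgn bias) * wave (x / 2 ^ k) * bias = norm bias * wave (x / 2 ^ k)"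
    using cnj_sgn_bias by (simp add: mult.assoc mult.left_commute)
  also have "Re (norm bias * wave (x / 2 ^ k)) = norm bias * cos (2 * pi * (x / 2 ^ k))"
    by (simp add: wave_def)
  finally have eq: "dmean k (\<lambda>z. test ((x + real z) / 2 ^ k))
      = norm bias * cos (2 * pi * (x / 2 ^ k))" .
  have "real (6 * q) \<le> real (2 ^ k)"
    using q_le_base by (rule of_nat_mono)
  then have "x / 2 ^ k \<le> 1 / 6"
    using assms by (simp add: field_simps)
  then have "2 * pi * (x / 2 ^ k) \<le> 2 * pi * (1 / 6)"
    by (intro mult_left_mono) simp_all
  then have "cos (pi / 3) \<le> cos (2 * pi * (x / 2 ^ k))"
    using assms by (intro cos_monotone_0_pi_le) auto
  then have "1 / 2 \<le> cos (2 * pi * (x / 2 ^ k))"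
    by (simp add: cos_60)
  then have "norm bias * (1 / 2) \<le> norm bias * cos (2 * pi * (x / 2 ^ k))"
    by (rule mult_left_mono) simp
  then show ?thesis unfolding eq by simp
qed

lemma norm_bias_le: "norm bias \<le> 1"
proof -
  have "norm bias = dmean k (\<lambda>z. test ((0 + real z) / 2 ^ k))"
  proof -
    have "dmean k (\<lambda>z. test ((0 + real z) / 2 ^ k)) = Re (cnj (sgn bias) * bias)"
      by (simp add: test_def bias_def Re_dmean dmean_mult_left[symmetric])
    also note cnj_sgn_bias
    finally show ?thesis by simp
  qed
  also have "\<dots> \<le> dmean k (\<lambda>z. 1)"
    using abs_test_le by (intro dmean_mono) (simp add: abs_le_iff)
  finally show ?thesis by simp
qed

section \<open>Exponential moments and Chernoff bounds\<close>

text \<open>In \<open>exp_le_quadratic\<close> the linear term sums to zero over the top block,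
  uniformly in the lower digits, so each block contributes a factor
  \<open>1 + s\<^sup>2\<close>.\<close>

lemma sum_exp_walk_le:
  assumes "0 \<le> s" "s \<le> 1"
  shows "(\<Sum>y<2 ^ (k * N). exp (s * walk N y)) \<le> 2 ^ (k * N) * (1 + s\<^sup>2) ^ N"
proof (induction N)
  case 0
  show ?case by (simp add: walk_def)
next
  case (Suc N)
  have *: "(\<Sum>z<2 ^ k. exp (s * test ((x + real z) / 2 ^ k))) \<le> 2 ^ k * (1 + s\<^sup>2)" for x
  proof -
    have "(\<Sum>z<2 ^ k. exp (s * test ((x + real z) / 2 ^ k)))
        \<le> (\<Sum>z<2 ^ k. 1 + s * test ((x + real z) / 2 ^ k) + s\<^sup>2)"
    proof (rule sum_mono)
      fix z
      define t where "t = test ((x + real z) / 2 ^ k)"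
      have t: "\<bar>t\<bar> \<le> 1" unfolding t_def by (rule abs_test_le)
      then have "\<bar>s * t\<bar> \<le> 1" "(s * t)\<^sup>2 \<le> s\<^sup>2"
        using assms by (auto simp: abs_mult power_mult_distrib mult_le_one abs_square_le_1
            intro: mult_left_le)
      then show "exp (s * t) \<le> 1 + s * t + s\<^sup>2"
        using exp_le_quadratic[of "s * t"] by linarith
    qed
    also have "\<dots> = 2 ^ k * (1 + s\<^sup>2)"
      by (simp add: sum.distrib sum_test_eq_0 algebra_simps flip: sum_distrib_left)
    finally show ?thesis .
  qed
  have "(\<Sum>y<2 ^ (k * Suc N). exp (s * walk (Suc N) y))
      = (\<Sum>y<2 ^ (k * N). \<Sum>z<2 ^ k. exp (s * walk (Suc N) (y + 2 ^ (k * N) * z)))"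
    using sum_lessThan_mult[of "\<lambda>y. exp (s * walk (Suc N) y)" "2 ^ k" "2 ^ (k * N)"]
    by (simp add: power_add)
  also have "\<dots> = (\<Sum>y<2 ^ (k * N). exp (s * walk N y) *
      (\<Sum>z<2 ^ k. exp (s * test ((real y / 2 ^ (k * N) + real z) / 2 ^ k))))"
    by (simp only: walk_Suc ring_distribs exp_add sum_distrib_left)
  also have "\<dots> \<le> (\<Sum>y<2 ^ (k * N). exp (s * walk N y) * (2 ^ k * (1 + s\<^sup>2)))"
    by (intro sum_mono mult_left_mono *) simp
  also have "\<dots> = (\<Sum>y<2 ^ (k * N). exp (s * walk N y)) * (2 ^ k * (1 + s\<^sup>2))"
    by (simp only: sum_distrib_right)
  also have "\<dots> \<le> (2 ^ (k * N) * (1 + s\<^sup>2) ^ N) * (2 ^ k * (1 + s\<^sup>2))"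
    by (intro mult_right_mono Suc.IH) simp
  also have "\<dots> = 2 ^ (k * Suc N) * (1 + s\<^sup>2) ^ Suc N"
    by (simp add: power_add)
  finally show ?case .
qed

text \<open>The same recursion over blocks, but now the linear term retains the drift from
  \<open>dmean_test_ge\<close>.\<close>

lemma dmean_exp_walk_le:
  assumes "0 \<le> s" "s \<le> 1"
  shows "dmean (k * N) (\<lambda>y. exp (- s * walk N y)) \<le> (1 - s * norm bias / 2 + s\<^sup>2) ^ N"
proof (induction N)
  case 0
  show ?case by (simp add: walk_def)
next
  case (Suc N)
  let ?c = "1 - s * norm bias / 2 + s\<^sup>2"
  have *: "dmean k (\<lambda>z. exp (- s * test ((x + real z) / 2 ^ k))) \<le> ?c"
    if "0 \<le> x" "x \<le> real q" for x
  proof -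
    have "dmean k (\<lambda>z. exp (- s * test ((x + real z) / 2 ^ k)))
        \<le> dmean k (\<lambda>z. (1 + s\<^sup>2) + (- s) * test ((x + real z) / 2 ^ k))"
    proof (rule dmean_mono)
      fix z :: nat
      define t where "t = test ((x + real z) / 2 ^ k)"
      have t: "\<bar>t\<bar> \<le> 1" unfolding t_def by (rule abs_test_le)
      then have "\<bar>- s * t\<bar> \<le> 1" "(- s * t)\<^sup>2 \<le> s\<^sup>2"
        using assms by (auto simp: abs_mult power_mult_distrib mult_le_one abs_square_le_1
            intro: mult_left_le)
      then show "exp (- s * t) \<le> (1 + s\<^sup>2) + - s * t"
        using exp_le_quadratic[of "- s * t"] by linarith
    qed
    also have "\<dots> = (1 + s\<^sup>2) + (- s) * dmean k (\<lambda>z. test ((x + real z) / 2 ^ k))"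
      by (simp only: dmean_sum dmean_const dmean_mult_left)
    also have "\<dots> \<le> ?c"
      using mult_left_mono[OF dmean_test_ge[OF that] assms(1)] by simp
    finally show ?thesis .
  qed
  \<comment> \<open>The induction hypothesis is multiplied by this factor below; it is nonnegative
    since \<open>s * norm bias \<le> 1\<close>.\<close>
  have c: "0 \<le> ?c"
    using mult_mono[OF assms(2) norm_bias_le] assms by simp
  have "dmean (k * Suc N) (\<lambda>y. exp (- s * walk (Suc N) y))
      = dmean (k * N) (\<lambda>y. dmean k (\<lambda>z. exp (- s * walk (Suc N) (y + 2 ^ (k * N) * z))))"
    using dmean_add[of "k * N" k "\<lambda>y. exp (- s * walk (Suc N) y)"] by (simp add: add.commute)
  also have "\<dots> = dmean (k * N) (\<lambda>y. exp (- s * walk N y) *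
      dmean k (\<lambda>z. exp (- s * test ((real y / 2 ^ (k * N) + real z) / 2 ^ k))))"
    by (simp only: walk_Suc ring_distribs exp_add dmean_mult_left)
  also have "\<dots> \<le> dmean (k * N) (\<lambda>y. exp (- s * walk N y) * ?c)"
  proof (rule dmean_mono)
    fix y assume y: "y + q \<le> q * 2 ^ (k * N)"
    then have "y \<le> q * 2 ^ (k * N)" by simp
    then have "real y \<le> real (q * 2 ^ (k * N))" by (rule of_nat_mono)
    then have "real y / 2 ^ (k * N) \<le> real q" by (simp add: field_simps)
    then show "exp (- s * walk N y) *
        dmean k (\<lambda>z. exp (- s * test ((real y / 2 ^ (k * N) + real z) / 2 ^ k)))
        \<le> exp (- s * walk N y) * ?c"
      by (intro mult_left_mono *) simp_all
  qed
  also have "\<dots> = ?c * dmean (k * N) (\<lambda>y. exp (- s * walk N y))"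
    unfolding dmean_mult_left[symmetric] by (simp add: mult.commute)
  also have "\<dots> \<le> ?c ^ Suc N"
    using mult_left_mono[OF Suc.IH c] by simp
  finally show ?case .
qed

text \<open>The rate \<open>s\<^sup>2 - s * norm bias / 4\<close> of the Chernoff bounds below at its minimiser
  \<open>s = norm bias / 8\<close>, which is the same for both bounds.\<close>
definition decay :: real where
  "decay = exp (- (norm bias)\<^sup>2 / 64)"

text \<open>The threshold lies halfway between 0, the mean of the walk over uniform residues, and
  \<open>N * norm bias / 2\<close>, a lower bound for its mean under \<open>dmean\<close>.\<close>

definition good :: "nat \<Rightarrow> nat set" where
  "good N = {y. y < q * 2 ^ (k * N) \<and> N * norm bias / 4 \<le> walk N y}"

lemma decay_pos: "0 < decay" and decay_less_1: "decay < 1"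
  using bias_nonzero by (simp_all add: decay_def)

lemma finite_good: "finite (good N)"
  by (rule finite_subset[of _ "{..<q * 2 ^ (k * N)}"]) (auto simp: good_def)

text \<open>Exponential Markov inequality; the candidates form \<open>q\<close> full periods of the
  walk.\<close>

lemma card_good_le: "real (card (good N)) \<le> q * 2 ^ (k * N) * decay ^ N"
proof -
  define s where "s = norm bias / 8"
  have s: "0 \<le> s" "s \<le> 1" using norm_bias_le by (auto simp: s_def)
  have *: "exp (- s * (N * norm bias / 4)) * (1 + s\<^sup>2) ^ N \<le> decay ^ N"
  proof -
    have "(1 + s\<^sup>2) ^ N \<le> exp (s\<^sup>2) ^ N"
      by (intro power_mono exp_ge_add_one_self) simp
    then have "exp (- s * (N * norm bias / 4)) * (1 + s\<^sup>2) ^ N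
        \<le> exp (- s * (N * norm bias / 4)) * exp (s\<^sup>2) ^ N"
      by (intro mult_left_mono) simp_all
    also have "\<dots> = decay ^ N"
      by (simp add: decay_def s_def power2_eq_square field_simps flip: exp_of_nat_mult exp_add)
    finally show ?thesis .
  qed
  have "real (card (good N)) = (\<Sum>y\<in>good N. 1)"
    by simp
  also have "\<dots> \<le> (\<Sum>y\<in>good N. exp (s * walk N y) * exp (- s * (N * norm bias / 4)))"
  proof (rule sum_mono)
    fix y assume "y \<in> good N"
    then have "s * (N * norm bias / 4) \<le> s * walk N y"
      using s by (intro mult_left_mono) (auto simp: good_def)
    then show "1 \<le> exp (s * walk N y) * exp (- s * (N * norm bias / 4))"
      by (simp flip: exp_add)
  qed
  also have "\<dots> \<le> (\<Sum>y<q * 2 ^ (k * N). exp (s * walk N y) * exp (- s * (N * norm bias / 4)))"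
    by (intro sum_mono2) (auto simp: good_def)
  also have "\<dots> = q * (\<Sum>y<2 ^ (k * N). exp (s * walk N y)) * exp (- s * (N * norm bias / 4))"
    by (simp add: sum_lessThan_mult walk_add_multiple flip: sum_distrib_right sum_distrib_left)
  also have "\<dots> \<le> q * (2 ^ (k * N) * (1 + s\<^sup>2) ^ N) * exp (- s * (N * norm bias / 4))"
    by (intro mult_right_mono mult_left_mono sum_exp_walk_le s) simp_all
  also have "\<dots> = q * 2 ^ (k * N) * (exp (- s * (N * norm bias / 4)) * (1 + s\<^sup>2) ^ N)"
    by (simp add: mult_ac)
  also have "\<dots> \<le> q * 2 ^ (k * N) * decay ^ N"
    by (intro mult_left_mono *) simp
  finally show ?thesis .
qed

text \<open>Exponential Markov inequality for the lower tail: the threshold gives back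
  \<open>s * norm bias / 4\<close> of the drift \<open>s * norm bias / 2\<close>.\<close>

lemma dmean_not_good_le: "dmean (k * N) (\<lambda>y. indicator (- good N) y) \<le> decay ^ N"
proof -
  define s where "s = norm bias / 8"
  have s: "0 \<le> s" "s \<le> 1" using norm_bias_le by (auto simp: s_def)
  let ?c = "1 - s * norm bias / 2 + s\<^sup>2"
  have "dmean (k * N) (\<lambda>y. indicator (- good N) y)
      \<le> dmean (k * N) (\<lambda>y. exp (s * (N * norm bias / 4)) * exp (- s * walk N y))"
  proof (rule dmean_mono)
    fix y assume "y + q \<le> q * 2 ^ (k * N)"
    then have y: "y < q * 2 ^ (k * N)" using q_pos by linarith
    show "indicator (- good N) y \<le> exp (s * (N * norm bias / 4)) * exp (- s * walk N y)"
    proof (cases "y \<in> good N")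
      case True
      then show ?thesis by simp
    next
      case False
      then have "s * walk N y \<le> s * (N * norm bias / 4)"
        using y s by (intro mult_left_mono) (auto simp: good_def)
      then show ?thesis using False by (simp flip: exp_add)
    qed
  qed
  also have "\<dots> \<le> exp (s * (N * norm bias / 4)) * ?c ^ N"
    unfolding dmean_mult_left by (intro mult_left_mono dmean_exp_walk_le s) simp
  also have "\<dots> \<le> exp (s * (N * norm bias / 4)) * exp (s\<^sup>2 - s * norm bias / 2) ^ N"
  proof (intro mult_left_mono power_mono)
    show "?c \<le> exp (s\<^sup>2 - s * norm bias / 2)"
      using exp_ge_add_one_self[of "s\<^sup>2 - s * norm bias / 2"] by linarith
    show "0 \<le> ?c" using mult_mono[OF s(2) norm_bias_le] s by simp
  qed simp
  also have "\<dots> = decay ^ N"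
    by (simp add: decay_def s_def power2_eq_square field_simps flip: exp_of_nat_mult exp_add)
  finally show ?thesis .
qed

end

section \<open>Hausdorff measure and dimension\<close>

lemma ennreal_eq_0_if_eventually_le_null_sequence:
  fixes x :: ennreal
  assumes "\<forall>\<^sub>F n in sequentially. x \<le> ennreal (f n)" "f \<longlonglongrightarrow> 0"
  shows "x = 0"
proof -
  have "(\<lambda>n. ennreal (f n)) \<longlonglongrightarrow> ennreal 0"
    using assms(2) by (rule tendsto_ennrealI)
  then have "x \<le> ennreal 0"
    using assms(1) by (rule tendsto_lowerbound) simp
  then show ?thesis by simp
qed

text \<open>A Borel-Cantelli argument: for every \<open>m\<close> the families from level
  \<open>m\<close> on cover the limsup set, and their total cost is the tail of a convergent
  geometric series.\<close>

lemma hausdorff_measure_limsup_eq_0: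
  fixes U :: "nat \<Rightarrow> nat \<Rightarrow> real set"
  assumes fin: "\<And>n. finite (I n)"
    and bdd: "\<And>n i. bounded (U n i)"
    and diam: "\<And>n i. diameter (U n i) \<le> d n" "d \<longlonglongrightarrow> 0"
    and s: "0 \<le> s"
    and card: "\<And>n. card (I n) * d n powr s \<le> C * r ^ n"
    and r: "0 \<le> r" "r < 1"
  shows "hausdorff_measure s (\<Inter>m. \<Union>n\<in>{m..}. \<Union>i\<in>I n. U n i) = 0"
proof -
  let ?A = "\<Inter>m. \<Union>n\<in>{m..}. \<Union>i\<in>I n. U n i"
  \<comment> \<open>Of the two factors \<open>\<tau> ^ n\<close>, one is bounded by
    \<open>\<tau> ^ m\<close> and tends to 0 with \<open>m\<close>, while the other is summed over
    \<open>n\<close>.\<close>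
  define \<tau> where "\<tau> = sqrt r"
  have \<tau>: "0 \<le> \<tau>" "\<tau> < 1" "\<And>n. r ^ n = \<tau> ^ n * \<tau> ^ n"
    using r by (auto simp: \<tau>_def simp flip: power_mult_distrib)
  have "C \<ge> 0"
    using card[of 0] order_trans[of 0 "card (I 0) * d 0 powr s" C] by simp
  have "hausdorff_pre s \<delta> ?A = 0" if "\<delta> > 0" for \<delta>
  proof (rule ennreal_eq_0_if_eventually_le_null_sequence)
    show "(\<lambda>m. C / (1 - \<tau>) * \<tau> ^ m) \<longlonglongrightarrow> 0"
      using LIMSEQ_realpow_zero[of \<tau>] \<tau> by (intro tendsto_mult_right_zero) auto
    have "\<forall>\<^sub>F n in sequentially. d n < \<delta>"
      using diam(2) that by (rule order_tendstoD)
    then obtain M where M: "\<And>n. n \<ge> M \<Longrightarrow> d n < \<delta>"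
      by (auto simp: eventually_sequentially)
    have "hausdorff_pre s \<delta> ?A \<le> ennreal (C / (1 - \<tau>) * \<tau> ^ m)" if "m \<ge> M" for m
    proof -
      \<comment> \<open>The double family is coded as one sequence by \<open>prod_decode\<close>.
        Padding with empty sets is free even for \<open>s = 0\<close>, because
        \<open>0 powr 0 = 0\<close>.\<close>
      define V where "V = (\<lambda>(n, i). if m \<le> n \<and> i \<in> I n then U n i else {})"
      have "?A \<subseteq> (\<Union>j. V (prod_decode j))"
      proof
        fix x assume "x \<in> ?A"
        then obtain n i where "m \<le> n" "i \<in> I n" "x \<in> U n i" by blast
        then have "x \<in> V (prod_decode (prod_encode (n, i)))" by (simp add: V_def)
        then show "x \<in> (\<Union>j. V (prod_decode j))" by blast
      qed
      moreover have "bounded (V z) \<and> diameter (V z) \<le> \<delta>" for z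
      proof (cases z)
        case (Pair n i)
        have "diameter (U n i) \<le> \<delta>" if "m \<le> n"
          using M[of n] \<open>m \<ge> M\<close> that diam(1)[of n i] by linarith
        then show ?thesis using bdd \<open>\<delta> > 0\<close> by (auto simp: V_def Pair)
      qed
      ultimately have "hausdorff_pre s \<delta> ?A \<le> (\<Sum>j. ennreal (diameter (V (prod_decode j)) powr s))"
        unfolding hausdorff_pre_def by (intro INF_lower) auto
      also have "\<dots> = (\<Sum>n. \<Sum>i. ennreal (diameter (V (n, i)) powr s))"
        by (rule suminf_ennreal_2dimen) simp
      also have "\<dots> \<le> (\<Sum>n. ennreal (C * \<tau> ^ m * \<tau> ^ n))"
      proof (intro suminf_le summableI)
        fix n
        have "(\<Sum>i. ennreal (diameter (V (n, i)) powr s))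
            = (\<Sum>i\<in>I n. ennreal (diameter (V (n, i)) powr s))"
          by (intro suminf_finite fin) (auto simp: V_def)
        also have "\<dots> \<le> ennreal (C * \<tau> ^ m * \<tau> ^ n)"
        proof (cases "m \<le> n")
          case True
          have "(\<Sum>i\<in>I n. ennreal (diameter (V (n, i)) powr s)) \<le> (\<Sum>i\<in>I n. ennreal (d n powr s))"
            using True diam(1) bdd s
            by (intro sum_mono ennreal_leI powr_mono2) (auto simp: V_def intro: diameter_ge_0)
          also have "\<dots> = ennreal (card (I n) * d n powr s)"
            by (simp add: ennreal_mult ennreal_of_nat_eq_real_of_nat)
          also have "\<dots> \<le> ennreal (C * (\<tau> ^ n * \<tau> ^ n))"
            using card[of n] by (intro ennreal_leI) (simp add: \<tau>)
          also have "\<dots> \<le> ennreal (C * (\<tau> ^ m * \<tau> ^ n))"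
            using \<open>C \<ge> 0\<close> \<tau> True
            by (intro ennreal_leI mult_left_mono mult_right_mono power_decreasing) auto
          finally show ?thesis by (simp add: mult.assoc)
        next
          case False
          then show ?thesis by (simp add: V_def)
        qed
        finally show "(\<Sum>i. ennreal (diameter (V (n, i)) powr s)) \<le> ennreal (C * \<tau> ^ m * \<tau> ^ n)" .
      qed
      also have "\<dots> = ennreal (\<Sum>n. C * \<tau> ^ m * \<tau> ^ n)"
        using \<open>C \<ge> 0\<close> \<tau> by (intro suminf_ennreal2 summable_mult summable_geometric) auto
      also have "(\<Sum>n. C * \<tau> ^ m * \<tau> ^ n) = C * \<tau> ^ m * (1 / (1 - \<tau>))"
        using \<tau> by (simp add: suminf_mult summable_geometric suminf_geometric)
      finally show ?thesis by (simp add: field_simps)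
    qed
    then show "\<forall>\<^sub>F m in sequentially. hausdorff_pre s \<delta> ?A \<le> ennreal (C / (1 - \<tau>) * \<tau> ^ m)"
      unfolding eventually_sequentially by blast
  qed
  then show ?thesis
    unfolding hausdorff_measure_def by (auto intro!: SUP_eq_const)
qed

lemma hausdorff_dim_le:
  assumes "0 \<le> s" "hausdorff_measure s A = 0"
  shows "hausdorff_dim A \<le> s"
  unfolding hausdorff_dim_def using assms by (intro cInf_lower bdd_belowI[of _ 0]) auto

text \<open>The infimum of the empty set of reals is an unspecified number, which therefore has to enter
  the lower bound.\<close>
lemma hausdorff_dim_bounded_below: "min 0 (Inf {}) \<le> hausdorff_dim A"
proof (cases "{s. 0 \<le> s \<and> hausdorff_measure s A = 0} = {}")
  case True
  then show ?thesis unfolding hausdorff_dim_def True by simp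
next
  case False
  then have "0 \<le> hausdorff_dim A"
    unfolding hausdorff_dim_def by (intro cInf_greatest) auto
  then show ?thesis by simp
qed

lemma measure_hausdorff_dim_le:
  assumes "A \<in> sets borel" "emeasure M (UNIV - A) = 0"
  shows "measure_hausdorff_dim M \<le> hausdorff_dim A"
  unfolding measure_hausdorff_dim_def
proof (rule cInf_lower)
  show "hausdorff_dim A \<in> {hausdorff_dim A |A. A \<in> sets borel \<and> emeasure M (UNIV - A) = 0}"
    using assms by blast
  show "bdd_below {hausdorff_dim A |A. A \<in> sets borel \<and> emeasure M (UNIV - A) = 0}"
    using hausdorff_dim_bounded_below by (intro bdd_belowI[of _ "min 0 (Inf {})"]) auto
qed

text \<open>If \<open>t\<close> is 0 or 1, two digits coincide and that point has weight 2/3; the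
  formula covers these cases too.\<close>

lemma nn_integral_digit_pmf:
  "(\<integral>\<^sup>+ x. f x \<partial>measure_pmf (digit_pmf t)) = (f 0 + f 1 + f t) * ennreal (1 / 3)"
proof -
  have "ennreal (2 / 3) = ennreal (1 / 3) + ennreal (1 / 3)"
    by (simp flip: ennreal_plus)
  then show ?thesis
    unfolding digit_pmf_def
    by (cases "t = 0"; cases "t = 1")
       (auto simp: nn_integral_measure_pmf_finite insert_commute algebra_simps)
qed

section \<open>Hausdorff dimension of the projected measure\<close>

context digit_walk
begin

abbreviation digit_space :: "(nat \<Rightarrow> real) measure" where
  "digit_space \<equiv> PiM UNIV (\<lambda>_. measure_pmf (digit_pmf (real p / real q)))"

definition part :: "nat \<Rightarrow> (nat \<Rightarrow> real) \<Rightarrow> real" where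
  "part n \<omega> = q * 2 ^ n * (\<Sum>i<n. \<omega> i / 2 ^ Suc i)"

lemma component_measurable [measurable]: "(\<lambda>\<omega>. \<omega> i) \<in> borel_measurable digit_space"
  by (rule measurable_compose[OF measurable_component_singleton]) auto

lemma part_measurable [measurable]: "part n \<in> borel_measurable digit_space"
  unfolding part_def by measurable

text \<open>A digit put in front of the sequence takes the top place \<open>2 ^ n\<close>, exactly
  as the new digit does in the recursion of \<open>dmean\<close>.\<close>

lemma part_Suc_case_nat:
  fixes d :: real
  shows "part (Suc n) (case_nat d \<omega>) = 2 ^ n * (q * d) + part n \<omega>"
proof -
  have "(\<Sum>i<n. \<omega> i / 2 ^ Suc (Suc i)) = (\<Sum>i<n. \<omega> i / 2 ^ Suc i) / 2"
    by (simp add: sum_divide_distrib)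
  then show ?thesis
    by (simp add: part_def sum.lessThan_Suc_shift algebra_simps del: sum.lessThan_Suc)
qed

text \<open>This identifies the law of \<open>part n\<close> with \<open>dmean n\<close>. The first
  digit is split off by \<open>PiM_iter\<close>; the set \<open>H\<close> varies in the induction
  because that digit translates it to \<open>H' d\<close>.\<close>

lemma nn_integral_part:
  assumes "H \<in> sets borel"
  shows "(\<integral>\<^sup>+ \<omega>. indicator H (part n \<omega>) \<partial>digit_space)
    = ennreal (dmean n (\<lambda>y. indicator H (real y)))"
  using assms
proof (induction n arbitrary: H)
  case 0
  interpret prob_space digit_space by (intro prob_space_PiM measure_pmf.prob_space_axioms)
  show ?case
    by (simp add: part_def emeasure_space_1 indicator_def)
next
  case (Suc n)
  let ?M = "measure_pmf (digit_pmf (real p / real q))"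
  interpret sequence_space ?M
    by (simp add: sequence_space_def product_prob_space_def product_sigma_finite_def
        product_prob_space_axioms_def measure_pmf.prob_space_axioms
        measure_pmf.sigma_finite_measure_axioms)
  have [measurable]: "H \<in> sets borel" by (rule Suc.prems)
  define H' where "H' d = (\<lambda>x. 2 ^ n * (q * d) + x) -` H" for d :: real
  have H': "H' d \<in> sets borel" for d
    unfolding H'_def using measurable_sets[of "\<lambda>x. 2 ^ n * (q * d) + x" borel borel H] by simp
  have mean: "dmean n (\<lambda>y. indicator (H' d) (real y)) = dmean n (\<lambda>y. indicator H (real (y + 2 ^ n * b)))"
    if "q * d = real b" for b :: nat and d :: real
    by (simp add: H'_def indicator_def that add.commute)
  have nonneg: "0 \<le> dmean n (\<lambda>y. indicator A (f y) :: real)" for A :: "real set" and f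
    using dmean_mono[of n "\<lambda>_. 0" "\<lambda>y. indicator A (f y)"] by simp
  have ennreal_mean: "(ennreal a + ennreal b + ennreal c) * ennreal (1 / 3) = ennreal ((a + b + c) / 3)"
    if "0 \<le> a" "0 \<le> b" "0 \<le> c" for a b c
    using that ennreal_mult[of "a + b + c" "1 / 3"] by (simp add: ennreal_plus)
  have cons: "(\<lambda>(d, \<omega>). case_nat d \<omega>) \<in> ?M \<Otimes>\<^sub>M digit_space \<rightarrow>\<^sub>M digit_space"
    by measurable
  have "(\<integral>\<^sup>+ \<omega>. indicator H (part (Suc n) \<omega>) \<partial>digit_space)
      = (\<integral>\<^sup>+ \<omega>. indicator H (part (Suc n) \<omega>)
          \<partial>distr (?M \<Otimes>\<^sub>M digit_space) digit_space (\<lambda>(d, \<omega>). case_nat d \<omega>))"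
    by (simp only: PiM_iter)
  also have "\<dots> = (\<integral>\<^sup>+ z. indicator H (part (Suc n) (case z of (d, \<omega>) \<Rightarrow> case_nat d \<omega>))
          \<partial>(?M \<Otimes>\<^sub>M digit_space))"
    by (rule nn_integral_distr) measurable
  also have "\<dots> = (\<integral>\<^sup>+ d. \<integral>\<^sup>+ \<omega>. indicator H (part (Suc n) (case_nat d \<omega>)) \<partial>digit_space \<partial>?M)"
    by (subst P.nn_integral_fst[symmetric])
      (rule measurable_compose[OF cons measurable_compose[OF part_measurable]], auto)
  also have "\<dots> = (\<integral>\<^sup>+ d. \<integral>\<^sup>+ \<omega>. indicator (H' d) (part n \<omega>) \<partial>digit_space \<partial>?M)"
    by (simp add: part_Suc_case_nat H'_def indicator_def)
  also have "\<dots> = (\<integral>\<^sup>+ d. ennreal (dmean n (\<lambda>y. indicator (H' d) (real y))) \<partial>?M)"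
    by (simp only: Suc.IH[OF H'])
  also have "\<dots> = ennreal ((dmean n (\<lambda>y. indicator (H' 0) (real y)) +
      dmean n (\<lambda>y. indicator (H' 1) (real y)) +
      dmean n (\<lambda>y. indicator (H' (real p / real q)) (real y))) / 3)"
    unfolding nn_integral_digit_pmf by (intro ennreal_mean nonneg)
  also have "\<dots> = ennreal (dmean (Suc n) (\<lambda>y. indicator H (real y)))"
    using q_pos by (simp add: mean[of 0 0] mean[of 1 q] mean[of "real p / real q" p])
  finally show ?case .
qed

lemma AE_digits: "AE \<omega> in digit_space. \<forall>i. 0 \<le> \<omega> i \<and> \<omega> i \<le> 1"
proof -
  have "AE x in measure_pmf (digit_pmf (real p / real q)). 0 \<le> x \<and> x \<le> 1"
    using q_pos p_le_q by (auto simp: AE_measure_pmf_iff digit_pmf_def)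
  then have "AE \<omega> in digit_space. 0 \<le> \<omega> i \<and> \<omega> i \<le> 1" for i
    by (intro AE_PiM_component measure_pmf.prob_space_axioms) auto
  then show ?thesis by (simp add: AE_all_countable)
qed

text \<open>With digits in [0,1], the tail after \<open>n\<close> terms lies between 0 and
  \<open>1 / 2 ^ n\<close>.\<close>

lemma suminf_digits_bounds:
  fixes \<omega> :: "nat \<Rightarrow> real"
  assumes "\<forall>i. 0 \<le> \<omega> i \<and> \<omega> i \<le> 1"
  shows "(\<Sum>i. \<omega> i / 2 ^ Suc i) \<in> {part n \<omega> / (q * 2 ^ n)..part n \<omega> / (q * 2 ^ n) + 1 / 2 ^ n}"
proof -
  have summable: "summable (\<lambda>i. \<omega> i / 2 ^ Suc i)"
  proof (rule summable_comparison_test')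
    show "summable (\<lambda>i. (1 / 2 :: real) ^ Suc i)"
      using power_half_series by (rule sums_summable)
    show "norm (\<omega> i / 2 ^ Suc i) \<le> (1 / 2) ^ Suc i" for i
      using assms by (simp add: power_one_over divide_right_mono)
  qed
  have split: "(\<Sum>i. \<omega> i / 2 ^ Suc i) = (\<Sum>i. \<omega> (i + n) / 2 ^ Suc (i + n)) + part n \<omega> / (q * 2 ^ n)"
    using suminf_split_initial_segment[OF summable, of n] q_pos by (simp add: part_def)
  have summable': "summable (\<lambda>i. \<omega> (i + n) / 2 ^ Suc (i + n))"
    using summable by (rule summable_ignore_initial_segment)
  have "0 \<le> (\<Sum>i. \<omega> (i + n) / 2 ^ Suc (i + n))"
    using assms by (intro suminf_nonneg summable') simp
  moreover have "(\<Sum>i. \<omega> (i + n) / 2 ^ Suc (i + n)) \<le> 1 / 2 ^ n"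
  proof -
    have *: "(\<lambda>i. (1 / 2) ^ Suc i * (1 / 2 ^ n)) sums (1 * (1 / 2 ^ n :: real))"
      by (intro sums_mult2 power_half_series)
    have "(\<Sum>i. \<omega> (i + n) / 2 ^ Suc (i + n)) \<le> (\<Sum>i. (1 / 2) ^ Suc i * (1 / 2 ^ n))"
    proof (intro suminf_le summable' sums_summable[OF *])
      show "\<omega> (i + n) / 2 ^ Suc (i + n) \<le> (1 / 2) ^ Suc i * (1 / 2 ^ n)" for i
        using assms by (simp add: power_add power_one_over divide_simps)
    qed
    also have "\<dots> = 1 / 2 ^ n" using * by (simp add: sums_iff)
    finally show ?thesis .
  qed
  ultimately show ?thesis unfolding split by simp
qed

section \<open>The limsup set of full measure and small dimension\<close>

definition cover :: "nat \<Rightarrow> real set" where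
  "cover N = (\<Union>y\<in>good N. {real y / (q * 2 ^ (k * N))..real y / (q * 2 ^ (k * N)) + 1 / 2 ^ (k * N)})"

lemma cover_borel [measurable]: "cover N \<in> sets borel"
  unfolding cover_def by (intro sets.finite_UN finite_good) auto

lemma emeasure_not_cover_le:
  "emeasure (proj_measure (real p / real q)) (- cover N) \<le> ennreal (decay ^ N)"
proof -
  let ?X = "\<lambda>\<omega>. \<Sum>i. \<omega> i / 2 ^ Suc i :: real"
  have X: "?X \<in> borel_measurable digit_space" by measurable
  have "emeasure (proj_measure (real p / real q)) (- cover N)
      = (\<integral>\<^sup>+ x. indicator (- cover N) x \<partial>proj_measure (real p / real q))"
    by (rule nn_integral_indicator[symmetric]) (simp add: proj_measure_def Compl_eq_Diff_UNIV)
  also have "\<dots> = (\<integral>\<^sup>+ \<omega>. indicator (- cover N) (?X \<omega>) \<partial>digit_space)"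
    unfolding proj_measure_def
    by (rule nn_integral_distr[OF X]) (simp add: Compl_eq_Diff_UNIV)
  \<comment> \<open>If \<open>part (k * N)\<close> takes a value in \<open>good N\<close>, the whole
    sum lies in the interval of \<open>cover N\<close> attached to that value.\<close>
  also have "\<dots> \<le> (\<integral>\<^sup>+ \<omega>. indicator (- real ` good N) (part (k * N) \<omega>) \<partial>digit_space)"
  proof (rule nn_integral_mono_AE)
    show "AE \<omega> in digit_space. (indicator (- cover N) (?X \<omega>) :: ennreal)
        \<le> indicator (- real ` good N) (part (k * N) \<omega>)"
      using AE_digits
    proof eventually_elim
      case (elim \<omega>)
      then show ?case
        using suminf_digits_bounds[OF elim, of "k * N"] by (auto simp: indicator_def cover_def)
    qed
  qed
  also have "\<dots> = ennreal (dmean (k * N) (\<lambda>y. indicator (- real ` good N) (real y)))"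
    using finite_good by (intro nn_integral_part borel_comp borel_closed finite_imp_closed) auto
  also have "(\<lambda>y. indicator (- real ` good N) (real y)) = (indicator (- good N) :: nat \<Rightarrow> real)"
    by (auto simp: indicator_def fun_eq_iff inj_image_mem_iff)
  also have "ennreal (dmean (k * N) (indicator (- good N))) \<le> ennreal (decay ^ N)"
    using dmean_not_good_le by (intro ennreal_leI)
  finally show ?thesis .
qed

text \<open>The complement is a countable union of tail intersections, each contained in
  \<open>- cover N\<close> for all large \<open>N\<close> and hence null.\<close>

lemma emeasure_limsup_cover:
  "emeasure (proj_measure (real p / real q)) (UNIV - (\<Inter>m. \<Union>N\<in>{m..}. cover N)) = 0"
proof -
  let ?\<mu> = "proj_measure (real p / real q)"
  have sets: "sets ?\<mu> = sets borel" by (simp add: proj_measure_def)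
  have "emeasure ?\<mu> (\<Inter>N\<in>{m..}. - cover N) = 0" for m
  proof (rule ennreal_eq_0_if_eventually_le_null_sequence)
    show "(\<lambda>N. decay ^ N) \<longlonglongrightarrow> 0"
      using decay_pos decay_less_1 by (intro LIMSEQ_realpow_zero) auto
    have "emeasure ?\<mu> (\<Inter>N\<in>{m..}. - cover N) \<le> ennreal (decay ^ N)" if "m \<le> N" for N
    proof -
      have "emeasure ?\<mu> (\<Inter>N\<in>{m..}. - cover N) \<le> emeasure ?\<mu> (- cover N)"
        using that by (intro emeasure_mono) (auto simp: sets)
      then show ?thesis using emeasure_not_cover_le by (rule order_trans)
    qed
    then show "\<forall>\<^sub>F N in sequentially. emeasure ?\<mu> (\<Inter>N\<in>{m..}. - cover N) \<le> ennreal (decay ^ N)"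
      unfolding eventually_sequentially by blast
  qed
  then have "emeasure ?\<mu> (\<Union>m. \<Inter>N\<in>{m..}. - cover N) = 0"
    by (intro emeasure_UN_eq_0) (auto simp: sets)
  moreover have "UNIV - (\<Inter>m. \<Union>N\<in>{m..}. cover N) = (\<Union>m. \<Inter>N\<in>{m..}. - cover N)"
    by auto
  ultimately show ?thesis by simp
qed

lemma hausdorff_dim_limsup_cover: "hausdorff_dim (\<Inter>m. \<Union>N\<in>{m..}. cover N) < 1"
proof -
  \<comment> \<open>Chosen so that \<open>2 ^ (k * N)\<close> to the power \<open>\<eta>\<close>
    equals \<open>1 / sqrt decay ^ N\<close>: lowering the exponent from 1 to
    \<open>1 - \<eta>\<close> uses up half of the decay in \<open>card_good_le\<close>.\<close>
  define \<eta> where "\<eta> = - ln decay / (2 * k * ln 2)"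
  define s where "s = max 0 (1 - \<eta>)"
  have "0 < \<eta>"
    using decay_pos decay_less_1 base_pos unfolding \<eta>_def
    by (intro divide_pos_pos) simp_all
  then have s: "0 \<le> s" "s < 1" "1 - \<eta> \<le> s"
    by (auto simp: s_def)
  have "hausdorff_measure s (\<Inter>m. \<Union>N\<in>{m..}. cover N) = 0"
    unfolding cover_def
  proof (rule hausdorff_measure_limsup_eq_0[OF finite_good])
    show "(\<lambda>N. 1 / 2 ^ (k * N)) \<longlonglongrightarrow> (0 :: real)"
      using LIMSEQ_realpow_zero[of "1 / 2 ^ k"] base_pos
      by (simp add: power_mult power_one_over)
    show "0 \<le> s" by (rule s)
    show "0 \<le> sqrt decay" "sqrt decay < 1"
      using decay_pos decay_less_1 by simp_all
    show "card (good N) * (1 / 2 ^ (k * N)) powr s \<le> q * sqrt decay ^ N" for N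
    proof -
      have "(1 / 2 ^ (k * N)) powr s \<le> (1 / 2 ^ (k * N) :: real) powr (1 - \<eta>)"
        using s by (intro powr_mono') auto
      also have "\<dots> = exp ((1 - \<eta>) * (- (k * N * ln 2)))"
        by (simp add: powr_def ln_div ln_realpow)
      also have "(1 - \<eta>) * (- (k * N * ln 2)) = - (k * N * ln 2) - N * (ln decay / 2)"
        using base_pos by (simp add: \<eta>_def field_simps)
      also have "exp \<dots> = 1 / (2 ^ (k * N) * sqrt decay ^ N)"
      proof -
        have "sqrt decay ^ N = exp (N * (ln decay / 2))"
          using decay_pos by (subst exp_of_nat_mult) (simp add: powr_def flip: powr_half_sqrt)
        moreover have "2 ^ (k * N) = exp (real (k * N) * ln 2)"
          by (subst exp_of_nat_mult) simp
        ultimately show ?thesis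
          by (simp only: exp_diff exp_minus) (simp add: divide_simps)
      qed
      finally have "card (good N) * (1 / 2 ^ (k * N)) powr s
          \<le> (q * 2 ^ (k * N) * decay ^ N) * (1 / (2 ^ (k * N) * sqrt decay ^ N))"
        using card_good_le[of N] decay_pos by (intro mult_mono) auto
      also have "decay ^ N = sqrt decay ^ N * sqrt decay ^ N"
        using decay_pos by (simp flip: power_mult_distrib)
      finally show ?thesis
        using decay_pos by simp
    qed
  qed (auto simp: diameter_closed_interval)
  then have "hausdorff_dim (\<Inter>m. \<Union>N\<in>{m..}. cover N) \<le> s"
    by (intro hausdorff_dim_le s)
  with s show ?thesis by linarith
qed

lemma measure_hausdorff_dim_less_1: "measure_hausdorff_dim (proj_measure (real p / real q)) < 1"
proof -
  have "measure_hausdorff_dim (proj_measure (real p / real q))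
      \<le> hausdorff_dim (\<Inter>m. \<Union>N\<in>{m..}. cover N)"
    by (intro measure_hausdorff_dim_le emeasure_limsup_cover) measurable
  then show ?thesis using hausdorff_dim_limsup_cover by linarith
qed

end

theorem theorem5p5:
  fixes p q :: nat
  assumes "coprime p q" and "q > 0" and "p \<le> q"
  shows "measure_hausdorff_dim (proj_measure (real p / real q)) < 1"
proof -
  \<comment> \<open>Any block length \<open>k\<close> with \<open>6 * q \<le> 2 ^ k\<close> would
    serve; \<open>6 * q\<close> itself is one.\<close>
  have "6 * q \<le> 2 ^ (6 * q)"
    by (rule less_imp_le) (rule less_exp)
  then interpret digit_walk p q "6 * q"
    using assms by unfold_locales
  show ?thesis by (rule measure_hausdorff_dim_less_1)
qed

end
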